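(* Let $f(x)=x^x$. Then, for any $a\in\mathbb{R}$, $f$ has the series expansion $$f(x)=f(a)\sum_{k=0}^{\infty}\frac{(x-a)^k}{k!}\sum_{i=0}^{k}\binom{k}{i}\frac{Q_i(a)}{a^{i-1}}\,\ln^{k-i}(a).$$ In the specific case $a=1$, $$f(x)=\sum_{k=0}^{\infty}\frac{(x-1)^k}{k!}\,Q_k(1).$$
   Context: The integers $\Omega(a,b)$, for $a\in\mathbb{Z}_{>0}$ and $b\in\mathbb{Z}_{\ge 0}$, are defined recursively by: $\Omega(a,0)=1$; $\Omega(a,b)=0$ if $b\ge a$ and $b\ge 1$; $\Omega(a,1)=\Omega(a-1,1)+1$ for $a\ge 2$; and $\Omega(a,b)=\Omega(a-1,b)-(b-1)\,\Omega(a-1,b-1)$ for $2\le b\le a-1$. The functions $Q_k(x)$ are defined by $Q_0(x)=\frac{1}{x}$ and $Q_k(x)=x\sum_{i=0}^{k-1}\Omega(k,i)\,Q_{k-1-i}(x)$ for $k=1,2,\dots$. The notation $\ln^{m}(a)$ means the power $(\ln a)^m$.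
   Formalization: The expansion is stated for nonzero a (at a = 0 the terms ln a and Q_0(a) = 1/a are undefined) and for |x − a| < |a|, since the series diverges for x beyond that distance; for a < 0, x^x and ln a are complex, taken with the principal logarithm. *)

theory Defs
  imports "HOL-Analysis.Analysis"
begin

text \<open>
  The first argument is meant to be positive; the value \<open>Omega 0 b\<close> is irrelevant.
\<close>

fun Omega :: "nat \<Rightarrow> nat \<Rightarrow> int" where
  "Omega a b =
     (if b = 0 then 1
      else if b \<ge> a then 0
      else if b = 1 then Omega (a - 1) 1 + 1
      else Omega (a - 1) b - (int b - 1) * Omega (a - 1) (b - 1))"

text \<open>The unconditional equation makes the simplifier loop.\<close>

declare Omega.simps [simp del]

text \<open>
  \<open>Q\<close> is generic in the field, since it is evaluated both at real arguments and,
  for the branch of \<open>x\<^sup>x\<close> on the negative axis, at real points seen as complex numbers.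
  The congruence rule is only needed for the termination proof of \<open>Q\<close>.
\<close>

context
  notes sum.cong [fundef_cong]
begin

fun Q :: "nat \<Rightarrow> 'a::field_char_0 \<Rightarrow> 'a" where
  "Q 0 x = 1 / x"
| "Q (Suc k) x = x * (\<Sum>i\<le>k. of_int (Omega (Suc k) i) * Q (k - i) x)"

end

end

theory Submission
  imports Defs "HOL-Complex_Analysis.Cauchy_Integral_Formula"
begin

text \<open>
  Write \<open>x = a (1 + s)\<close>, so that \<open>s = (x - a) / a\<close>. As \<open>1 + s\<close> is a positive real,
  \<open>ln x = ln a + ln (1 + s)\<close>, also on the principal branch when \<open>a < 0\<close>. Hence
  \<open>x\<^sup>x = a\<^sup>a \<cdot> exp ((x - a) ln a) \<cdot> G s\<close> with \<open>G s = exp (a (1 + s) ln (1 + s))\<close>.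

  The numbers \<open>\<Omega>\<close> arise from the logarithmic derivative of \<open>G\<close>. Since
  \<open>G' = a (1 + ln (1 + s)) G\<close>, Leibniz' rule gives a recursion for the derivatives
  \<open>G\<^sup>(\<^sup>k\<^sup>) 0\<close> whose coefficients are \<open>a\<close> times \<open>k choose i\<close> times the \<open>i\<close>-th derivative of
  \<open>1 + ln (1 + s)\<close> at \<open>0\<close>. The latter product is \<open>\<Omega> (k + 1, i)\<close> by Pascal's rule
  (\<open>Omega_Suc_eq\<close>), so the recursion is the one that defines \<open>Q\<close>, and
  \<open>G\<^sup>(\<^sup>k\<^sup>) 0 = a Q\<^sub>k a\<close> (\<open>higher_deriv_self_power_factor\<close>).

  \<open>G\<close> is holomorphic on the open unit disc, so its Taylor series converges absolutely for
  \<open>\<bar>s\<bar> < 1\<close>. The stated double sum is the Cauchy product of that series with the exponential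
  series of \<open>exp ((x - a) ln a)\<close> (\<open>self_power_sums\<close>). The argument runs over the complex numbers, which
  covers both signs of \<open>a\<close>; for \<open>a > 0\<close> all quantities are real. For \<open>a = 1\<close> the factor
  \<open>ln a\<close> vanishes and only the terms with \<open>i = k\<close> survive.
\<close>

section \<open>The numbers \<open>\<Omega>\<close> as Leibniz coefficients\<close>

text \<open>
  These are the derivatives of \<open>1 + ln (1 + s)\<close> at \<open>0\<close>, kept as integers in order to be
  comparable with \<open>\<Omega>\<close>.
\<close>

definition log_coeff :: "nat \<Rightarrow> int" where
  "log_coeff i = (if i = 0 then 1 else (-1) ^ (i - 1) * fact (i - 1))"

text \<open>
  Pascal's rule turns into the recursion of \<open>\<Omega>\<close> because consecutive derivatives of the
  logarithm differ by the factor \<open>- (i - 1)\<close>. This fails between \<open>i = 0\<close> and \<open>i = 1\<close>, where both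
  derivatives of \<open>1 + ln (1 + s)\<close> at \<open>0\<close> are \<open>1\<close>; hence the separate recursion for \<open>\<Omega> (a, 1)\<close>.
\<close>

lemma Omega_Suc_eq: "Omega (Suc k) i = int (k choose i) * log_coeff i"
proof (induction k arbitrary: i)
  case 0
  show ?case
    by (subst Omega.simps) (auto simp: log_coeff_def)
next
  case (Suc k)
  consider "i = 0" | "i = 1" | "i > Suc k" | j where "i = Suc (Suc j)" "i \<le> Suc k"
    by (metis One_nat_def not0_implies_Suc not_less)
  then show ?case
  proof cases
    case 4
    have "log_coeff (Suc (Suc j)) = - (int j + 1) * log_coeff (Suc j)"
      by (simp add: log_coeff_def algebra_simps)
    then show ?thesis
      using 4 by (subst Omega.simps) (simp add: Suc.IH ring_distribs)
  qed (subst Omega.simps, simp add: Suc.IH log_coeff_def)+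
qed

lemma one_plus_notin_nonpos:
  fixes s :: complex
  assumes "norm s < 1"
  shows "1 + s \<notin> \<real>\<^sub>\<le>\<^sub>0"
  using assms abs_Re_le_cmod[of s] by (auto simp: complex_nonpos_Reals_iff)

lemma higher_deriv_Ln_Suc:
  assumes "norm s < 1"
  shows "(deriv ^^ Suc n) (\<lambda>s. 1 + Ln (1 + s)) s = (-1) ^ n * fact n / (1 + s) ^ Suc n"
  using assms
proof (induction n arbitrary: s)
  case 0
  have "1 + s \<notin> \<real>\<^sub>\<le>\<^sub>0"
    using 0 one_plus_notin_nonpos by blast
  then show ?case
    by (auto intro!: DERIV_imp_deriv derivative_eq_intros simp: inverse_eq_divide)
next
  case (Suc n)
  have nz: "1 + s \<noteq> 0"
    using Suc.prems by (metis add_eq_0_iff less_irrefl norm_minus_cancel norm_one)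
  have "\<forall>\<^sub>F w in nhds s. norm w < 1"
    using Suc.prems eventually_nhds_in_open[of "ball 0 1" s] by simp
  then have "\<forall>\<^sub>F w in nhds s. (deriv ^^ Suc n) (\<lambda>s. 1 + Ln (1 + s)) w
                                  = (-1) ^ n * fact n / (1 + w) ^ Suc n"
    by eventually_elim (rule Suc.IH)
  then have "(deriv ^^ Suc (Suc n)) (\<lambda>s. 1 + Ln (1 + s)) s
             = deriv (\<lambda>w. (-1) ^ n * fact n / (1 + w) ^ Suc n) s"
    unfolding funpow.simps(2)[of "Suc n"] o_def by (rule deriv_cong_ev) simp
  also have "\<dots> = (-1) ^ Suc n * fact (Suc n) / (1 + s) ^ Suc (Suc n)"
  proof (rule DERIV_imp_deriv)
    let ?c = "(-1) ^ n * fact n :: complex" and ?z = "1 + s"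
    have "((\<lambda>w. ?c / (1 + w) ^ Suc n) has_field_derivative
            - (?c * (of_nat (Suc n) * ?z ^ n)) / (?z ^ Suc n * ?z ^ Suc n)) (at s)"
      using nz by (auto intro!: derivative_eq_intros simp del: power_Suc of_nat_Suc)
    moreover have "- (c * (m * z ^ n)) / (z ^ Suc n * z ^ Suc n) = - c * m / z ^ Suc (Suc n)"
      if "z \<noteq> 0" for c m z :: complex
      using that by (simp add: field_simps)
    ultimately show "((\<lambda>w. ?c / (1 + w) ^ Suc n) has_field_derivative
            (-1) ^ Suc n * fact (Suc n) / ?z ^ Suc (Suc n)) (at s)"
      using nz by (simp add: mult_ac del: power_Suc of_nat_Suc) (simp add: mult_ac)
  qed
  finally show ?case .
qed

lemma higher_deriv_log_coeff:
  "(deriv ^^ i) (\<lambda>s. 1 + Ln (1 + s)) 0 = of_int (log_coeff i)"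
proof (cases i)
  case (Suc n)
  then show ?thesis
    using higher_deriv_Ln_Suc[of 0 n] by (simp add: log_coeff_def del: funpow.simps)
qed (simp add: log_coeff_def)

section \<open>The Taylor series of the normalised self-power\<close>

definition self_power_factor :: "complex \<Rightarrow> complex \<Rightarrow> complex" where
  "self_power_factor A s = exp (A * (1 + s) * Ln (1 + s))"

lemma DERIV_self_power_factor:
  assumes "norm s < 1"
  shows "(self_power_factor A has_field_derivative
           A * ((1 + Ln (1 + s)) * self_power_factor A s)) (at s)"
proof -
  have "1 + s \<notin> \<real>\<^sub>\<le>\<^sub>0"
    using assms one_plus_notin_nonpos by blast
  moreover from this have nz: "1 + s \<noteq> 0"
    by auto
  ultimately have "((\<lambda>s. A * (1 + s) * Ln (1 + s)) has_field_derivative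
                     A * Ln (1 + s) + A * (1 + s) * inverse (1 + s)) (at s)"
    by (auto intro!: derivative_eq_intros simp: divide_inverse)
  moreover have "A * Ln (1 + s) + A * (1 + s) * inverse (1 + s) = A * (1 + Ln (1 + s))"
    using nz by (simp add: mult.assoc distrib_left[of A 1 "Ln (1 + s)"])
  ultimately have "((\<lambda>s. A * (1 + s) * Ln (1 + s)) has_field_derivative
                     A * (1 + Ln (1 + s))) (at s)"
    by (simp only:)
  from DERIV_chain2[OF DERIV_exp this] show ?thesis
    unfolding self_power_factor_def[abs_def] by (rule DERIV_cong) (simp add: mult_ac)
qed

lemma holomorphic_self_power_factor: "self_power_factor A holomorphic_on ball 0 1"
  using DERIV_self_power_factor by (subst holomorphic_on_open) (auto, blast)

lemma holomorphic_one_plus_Ln: "(\<lambda>s. 1 + Ln (1 + s)) holomorphic_on ball 0 1"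
  using one_plus_notin_nonpos by (auto intro!: holomorphic_intros)

text \<open>
  The factor \<open>A\<close> on the right compensates for \<open>Q 0 A = 1 / A\<close>, whereas the function takes the value
  \<open>1\<close> at \<open>0\<close>.
\<close>

lemma higher_deriv_self_power_factor:
  assumes "A \<noteq> 0"
  shows "(deriv ^^ k) (self_power_factor A) 0 = A * Q k A"
proof (induction k rule: less_induct)
  case (less k)
  show ?case
  proof (cases k)
    case 0
    then show ?thesis
      using assms by (simp add: self_power_factor_def)
  next
    case (Suc n)
    let ?L = "\<lambda>s. 1 + Ln (1 + s)" and ?G = "self_power_factor A"
    have "\<forall>\<^sub>F s in nhds 0. norm (s :: complex) < 1"
      using eventually_nhds_in_open[of "ball 0 1" "0 :: complex"] by simp
    then have "\<forall>\<^sub>F s in nhds 0. deriv ?G s = A * (?L s * ?G s)"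
      by eventually_elim (simp add: DERIV_self_power_factor DERIV_imp_deriv)
    then have "(deriv ^^ k) ?G 0 = (deriv ^^ n) (\<lambda>s. A * (?L s * ?G s)) 0"
      unfolding Suc funpow_Suc_right o_def by (rule higher_deriv_cong_ev) simp
    also have "\<dots> = A * (deriv ^^ n) (\<lambda>s. ?L s * ?G s) 0"
      by (rule higher_deriv_cmult[where A = "ball 0 1"])
        (auto intro!: holomorphic_on_mult holomorphic_self_power_factor holomorphic_one_plus_Ln)
    also have "(deriv ^^ n) (\<lambda>s. ?L s * ?G s) 0
               = (\<Sum>i\<le>n. of_nat (n choose i) * (deriv ^^ i) ?L 0 * (deriv ^^ (n - i)) ?G 0)"
      using higher_deriv_mult[OF holomorphic_one_plus_Ln holomorphic_self_power_factor, of 0]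
      by (simp add: atMost_atLeast0)
    also have "\<dots> = (\<Sum>i\<le>n. of_int (Omega (Suc n) i) * (A * Q (n - i) A))"
      using Suc by (intro sum.cong) (auto simp: higher_deriv_log_coeff less Omega_Suc_eq)
    also have "A * \<dots> = A * Q k A"
      using Suc by (simp add: sum_distrib_left algebra_simps)
    finally show ?thesis .
  qed
qed

lemma self_power_factor_sums:
  assumes "A \<noteq> 0" and "norm s < 1"
  shows "(\<lambda>k. A * Q k A / fact k * s ^ k) sums self_power_factor A s"
  using holomorphic_power_series[OF holomorphic_self_power_factor[of A], of s] assms
  by (simp add: higher_deriv_self_power_factor)

lemma self_power_factor_abs_summable:
  fixes A s :: complex
  assumes "A \<noteq> 0" and "norm s < 1"
  shows "summable (\<lambda>k. norm (A * Q k A / fact k * s ^ k))"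
proof -
  obtain r where "norm s < r" "r < 1"
    using assms(2) dense by blast
  then have "norm (complex_of_real r) < 1" "norm s < norm (complex_of_real r)"
    using norm_ge_zero[of s] by (auto simp del: norm_ge_zero)
  then show ?thesis
    using powser_insidea[of "\<lambda>k. A * Q k A / fact k :: complex" "complex_of_real r" s]
      sums_summable[OF self_power_factor_sums[OF assms(1)]] by blast
qed

section \<open>Expansion of the self-power\<close>

definition expansion_term ::
    "'a::{real_normed_field, ln} \<Rightarrow> 'a \<Rightarrow> nat \<Rightarrow> 'a" where
  "expansion_term a x k = (x - a) ^ k / fact k *
     (\<Sum>i\<le>k. of_nat (k choose i) * (Q i a / a powi (int i - 1)) * ln a ^ (k - i))"

text \<open>
  In the Cauchy product, \<open>(x - a)\<^sup>k\<close> splits into \<open>(x - a)\<^sup>i\<close> for the normalised self-power, whose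
  argument \<open>(x - a) / a\<close> supplies the powers of \<open>a\<close> in the denominator, and \<open>(x - a)\<^sup>k\<^sup>-\<^sup>i\<close> for the
  exponential series.
\<close>

lemma expansion_term_eq_Cauchy:
  assumes "a \<noteq> 0"
  shows "expansion_term a x k =
    (\<Sum>i\<le>k. (a * Q i a / fact i * ((x - a) / a) ^ i)
                * (((x - a) * ln a) ^ (k - i) /\<^sub>R fact (k - i)))"
  unfolding expansion_term_def sum_distrib_left
proof (intro sum.cong refl)
  fix i assume "i \<in> {..k}"
  then have "i \<le> k"
    by simp
  then have "(x - a) ^ k = (x - a) ^ i * (x - a) ^ (k - i)"
    by (simp flip: power_add)
  moreover have "a powi (int i - 1) = a ^ i / a"
    using assms by (simp add: power_int_diff)
  moreover have "(of_nat (k choose i) :: 'a) = fact k / (fact i * fact (k - i))"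
    using \<open>i \<le> k\<close> by (rule binomial_fact)
  ultimately show "(x - a) ^ k / fact k *
        (of_nat (k choose i) * (Q i a / a powi (int i - 1)) * ln a ^ (k - i))
      = (a * Q i a / fact i * ((x - a) / a) ^ i)
          * (((x - a) * ln a) ^ (k - i) /\<^sub>R fact (k - i))"
    using assms by (simp only: scaleR_conv_of_real power_mult_distrib power_divide)
      (simp add: field_simps)
qed

text \<open>
  The condition forces \<open>x / a > 0\<close>, so \<open>x\<close> and \<open>a\<close> have the same argument and their principal
  logarithms differ by the real number \<open>ln (x / a)\<close>, even on the branch cut.
\<close>

lemma self_power_factorization:
  fixes a x :: real
  assumes "\<bar>x - a\<bar> < \<bar>a\<bar>"
  defines "A \<equiv> complex_of_real a" and "X \<equiv> complex_of_real x"
  shows "X powr X = A powr A * (self_power_factor A ((X - A) / A) * exp ((X - A) * Ln A))"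
proof -
  have nz: "a \<noteq> 0" and pos: "x / a > 0"
    using assms(1) by (auto simp: zero_less_divide_iff)
  have A: "A \<noteq> 0" and X: "X \<noteq> 0"
    using nz pos by (auto simp: A_def X_def)
  have quot: "1 + (X - A) / A = complex_of_real (x / a)"
    using A by (simp add: A_def X_def field_simps)
  have "X = complex_of_real (x / a) * A"
    using nz by (simp add: A_def X_def)
  then have Ln_X: "Ln X = Ln (1 + (X - A) / A) + Ln A"
    unfolding quot using Ln_times_of_real[OF pos A] by (simp only:)
  have "A * (1 + (X - A) / A) = X"
    using A by (simp add: field_simps)
  then show ?thesis
    using A X by (simp add: self_power_factor_def powr_def Ln_X algebra_simps flip: exp_add)
qed

lemma self_power_sums:
  fixes a x :: real
  assumes "\<bar>x - a\<bar> < \<bar>a\<bar>"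
  defines "A \<equiv> complex_of_real a" and "X \<equiv> complex_of_real x"
  shows "\<exists>S. expansion_term A X sums S \<and> X powr X = A powr A * S"
proof (intro exI conjI)
  let ?s = "(X - A) / A"
  have A: "A \<noteq> 0" and s: "norm ?s < 1"
    using assms(1) by (auto simp: A_def X_def norm_divide simp flip: of_real_diff)
  have "(\<lambda>k. \<Sum>i\<le>k. (A * Q i A / fact i * ?s ^ i)
                      * (((X - A) * Ln A) ^ (k - i) /\<^sub>R fact (k - i)))
        sums (self_power_factor A ?s * exp ((X - A) * Ln A))"
    using Cauchy_product_sums[OF self_power_factor_abs_summable[OF A s]
        summable_norm_exp[of "(X - A) * Ln A"]]
    unfolding sums_unique[OF self_power_factor_sums[OF A s], symmetric] exp_def .
  then show "expansion_term A X sums (self_power_factor A ?s * exp ((X - A) * Ln A))"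
    by (simp add: expansion_term_eq_Cauchy[OF A, abs_def])
  show "X powr X = A powr A * (self_power_factor A ?s * exp ((X - A) * Ln A))"
    unfolding A_def X_def by (rule self_power_factorization[OF assms(1)])
qed

lemma Q_of_real: "Q k (complex_of_real a) = complex_of_real (Q k a)"
proof (induction k rule: less_induct)
  case (less k)
  then show ?case
    by (cases k) auto
qed

lemma expansion_term_of_real:
  assumes "a > 0"
  shows "expansion_term (complex_of_real a) (complex_of_real x) k
         = complex_of_real (expansion_term a x k)"
  using assms by (simp add: expansion_term_def Q_of_real Ln_of_real)

lemma self_power_sums_real:
  fixes a x :: real
  assumes "0 < a" and "\<bar>x - a\<bar> < a"
  shows "summable (expansion_term a x) \<and> x powr x = a powr a * suminf (expansion_term a x)"
proof -
  obtain S where S: "expansion_term (complex_of_real a) (complex_of_real x) sums S"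
      and eq: "complex_of_real x powr complex_of_real x
               = complex_of_real a powr complex_of_real a * S"
    using self_power_sums[of x a] assms by auto
  have x: "0 < x"
    using assms by linarith
  have "complex_of_real (a powr a) * S = complex_of_real (x powr x)"
    using eq assms x by (simp add: powr_of_real)
  moreover have "a powr a \<noteq> 0"
    using assms by simp
  ultimately have "S = complex_of_real (x powr x / a powr a)"
    by (simp add: field_simps)
  then have "expansion_term a x sums (x powr x / a powr a)"
    using S by (simp only: expansion_term_of_real[OF assms(1), abs_def] sums_of_real_iff)
  then show ?thesis
    using \<open>a powr a \<noteq> 0\<close> by (auto dest: sums_unique sums_summable simp flip: sums_unique)
qed

lemma expansion_term_one:
  fixes x :: real
  shows "expansion_term 1 x k = (x - 1) ^ k / fact k * Q k 1"
proof -
  have "(\<Sum>i\<le>k. of_nat (k choose i) * (Q i (1 :: real) / 1 powi (int i - 1)) * ln 1 ^ (k - i))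
        = (\<Sum>i\<le>k. if i = k then Q k 1 else 0)"
    by (intro sum.cong) (auto simp: power_0_left)
  then show ?thesis
    by (simp add: expansion_term_def)
qed

theorem mainTheorem7:
  shows "(\<forall>a x :: real. 0 < a \<and> \<bar>x - a\<bar> < a \<longrightarrow>
           summable (\<lambda>k. (x - a) ^ k / fact k *
             (\<Sum>i\<le>k. of_nat (k choose i) * (Q i a / a powi (int i - 1)) * ln a ^ (k - i))) \<and>
           x powr x = a powr a * (\<Sum>k. (x - a) ^ k / fact k *
             (\<Sum>i\<le>k. of_nat (k choose i) * (Q i a / a powi (int i - 1)) * ln a ^ (k - i)))) \<and>
         (\<forall>a x :: real. a < 0 \<and> \<bar>x - a\<bar> < \<bar>a\<bar> \<longrightarrow>
           (let A = complex_of_real a; X = complex_of_real x in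
           summable (\<lambda>k. (X - A) ^ k / fact k *
             (\<Sum>i\<le>k. of_nat (k choose i) * (Q i A / A powi (int i - 1)) * ln A ^ (k - i))) \<and>
           X powr X = A powr A * (\<Sum>k. (X - A) ^ k / fact k *
             (\<Sum>i\<le>k. of_nat (k choose i) * (Q i A / A powi (int i - 1)) * ln A ^ (k - i))))) \<and>
         (\<forall>x :: real. \<bar>x - 1\<bar> < 1 \<longrightarrow>
           summable (\<lambda>k. (x - 1) ^ k / fact k * Q k 1) \<and>
           x powr x = (\<Sum>k. (x - 1) ^ k / fact k * Q k 1))"
proof (intro conjI allI impI, goal_cases)
  case (1 a x)
  then show ?case
    using self_power_sums_real[of a x] unfolding expansion_term_def by blast
next
  case (2 a x)
  then show ?case
    using self_power_sums_real[of a x] unfolding expansion_term_def by blast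
next
  case (3 a x)
  then obtain S where
    "expansion_term (complex_of_real a) (complex_of_real x) sums S"
    "complex_of_real x powr complex_of_real x = complex_of_real a powr complex_of_real a * S"
    using self_power_sums by blast
  then show ?case
    unfolding Let_def expansion_term_def by (auto simp: sums_iff)
next
  case (4 x)
  then show ?case
    using self_power_sums_real[of 1 x] by (simp add: expansion_term_one[abs_def])
next
  case (5 x)
  then show ?case
    using self_power_sums_real[of 1 x] by (simp add: expansion_term_one[abs_def])
qed

end
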